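(* The Minimum Compare Set problem is approximable in polynomial time within a factor $O(\log|B|)$: there is a polynomial-time algorithm which, given a finite set $A=\{a_1,\dots,a_m\}$ and a collection $B=\{b_1,\dots,b_n\}$ of subsets of $A$, outputs a compare set for $(A,B)$ whose cardinality is at most $O(\log|B|)$ times the minimum cardinality of a compare set for $(A,B)$.
   Context: A subset $X\subseteq A$ is called a compare set for $(A,B)$ if for any two sets $b_i,b_j\in B$, $b_i\subseteq b_j$ if and only if $(b_i\cap X)\subseteq(b_j\cap X)$. The Minimum Compare Set problem asks, given $(A,B)$, for a compare set of minimum cardinality. *)

theory Defs
  imports "HOL-Computational_Algebra.Polynomial" "HOL-Library.Landau_Symbols"
begin

section \<open>Compare sets\<close>

definition compare_set :: "'a set \<Rightarrow> 'a set set \<Rightarrow> 'a set \<Rightarrow> bool" where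
  "compare_set A B X \<longleftrightarrow>
     X \<subseteq> A \<and> (\<forall>b\<in>B. \<forall>b'\<in>B. b \<subseteq> b' \<longleftrightarrow> b \<inter> X \<subseteq> b' \<inter> X)"

text \<open>Meaningful for finite \<open>A\<close>; the set of compare sets is then finite, and it contains \<open>A\<close>
  whenever \<open>B \<subseteq> Pow A\<close>.\<close>

definition min_compare_card :: "'a set \<Rightarrow> 'a set set \<Rightarrow> nat" where
  "min_compare_card A B = Min (card ` {X. compare_set A B X})"


section \<open>Deterministic multi-tape Turing machines\<close>

text \<open>A machine has control states \<open>{0..n_states}\<close>, where \<open>0\<close> is the start state and \<open>n_states\<close>
  the only halting state, and tape symbols \<open>{0..<n_symbols}\<close>, where \<open>0\<close> is the blank. From a state
  and the list of symbols under the heads, \<open>delta\<close> yields the next state and, for every tape, the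
  symbol to write and the head movement (\<open>-1\<close>, \<open>0\<close> or \<open>1\<close>).\<close>

record tm =
  n_tapes :: nat
  n_states :: nat
  n_symbols :: nat
  delta :: "nat \<Rightarrow> nat list \<Rightarrow> nat \<times> (nat \<times> int) list"

text \<open>At least four symbols are required because words below use the symbols \<open>1\<close>, \<open>2\<close>, \<open>3\<close>.
  The values of \<open>delta\<close> outside the domain constrained here are never consulted in a run.\<close>

definition turing_machine :: "tm \<Rightarrow> bool" where
  "turing_machine M \<longleftrightarrow>
     n_tapes M \<ge> 1 \<and> n_symbols M \<ge> 4 \<and>
     (\<forall>q < n_states M. \<forall>rs. length rs = n_tapes M \<longrightarrow> set rs \<subseteq> {..<n_symbols M} \<longrightarrow>
        (case delta M q rs of (q', acts) \<Rightarrow>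
           q' \<le> n_states M \<and> length acts = n_tapes M \<and>
           set acts \<subseteq> {..<n_symbols M} \<times> {-1, 0, 1}))"

text \<open>A two-way infinite tape: its contents and the position of the head.\<close>

type_synonym tape = "(int \<Rightarrow> nat) \<times> int"

type_synonym config = "nat \<times> tape list"

definition read_tape :: "tape \<Rightarrow> nat" where
  "read_tape = (\<lambda>(c, h). c h)"

definition act_tape :: "nat \<times> int \<Rightarrow> tape \<Rightarrow> tape" where
  "act_tape = (\<lambda>(s, d) (c, h). (c(h := s), h + d))"

definition tm_step :: "tm \<Rightarrow> config \<Rightarrow> config" where
  "tm_step M = (\<lambda>(q, ts).
     if q = n_states M then (q, ts)
     else (case delta M q (map read_tape ts) of (q', acts) \<Rightarrow> (q', map2 act_tape acts ts)))"

definition word_contents :: "nat list \<Rightarrow> int \<Rightarrow> nat" where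
  "word_contents w = (\<lambda>i. if 0 \<le> i \<and> i < int (length w) then w ! nat i else 0)"

text \<open>Tape \<open>0\<close> serves both as input tape and as output tape.\<close>

definition tm_init :: "tm \<Rightarrow> nat list \<Rightarrow> config" where
  "tm_init M w =
     (0, (word_contents w, 0) # replicate (n_tapes M - 1) (word_contents [], 0))"

text \<open>Since the halting state is never left, this means that \<open>M\<close> halts after at most \<open>t\<close> steps.\<close>

definition tm_outputs_within :: "tm \<Rightarrow> nat list \<Rightarrow> nat \<Rightarrow> nat list \<Rightarrow> bool" where
  "tm_outputs_within M w t v \<longleftrightarrow>
     (\<exists>ts. (tm_step M ^^ t) (tm_init M w) = (n_states M, ts) \<and> fst (ts ! 0) = word_contents v)"


section \<open>Instances and solutions as words\<close>

text \<open>\<open>(xs, bs)\<close> are enumerations \<open>a\<^sub>1, \<dots>, a\<^sub>m\<close> and \<open>b\<^sub>1, \<dots>, b\<^sub>n\<close> of \<open>A\<close> and \<open>B\<close>; in particular \<open>A\<close>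
  and \<open>B\<close> are finite.\<close>

definition enumerates :: "'a list \<Rightarrow> 'a set list \<Rightarrow> 'a set \<Rightarrow> 'a set set \<Rightarrow> bool" where
  "enumerates xs bs A B \<longleftrightarrow>
     distinct xs \<and> set xs = A \<and> distinct bs \<and> set bs = B \<and> B \<subseteq> Pow A"

text \<open>The characteristic vector of \<open>X\<close>, with the symbols \<open>1\<close> for "absent" and \<open>2\<close> for "present".\<close>

definition subset_word :: "'a list \<Rightarrow> 'a set \<Rightarrow> nat list" where
  "subset_word xs X = map (\<lambda>a. if a \<in> X then 2 else 1) xs"

text \<open>The rows of the incidence matrix of \<open>B\<close>, preceded by a row for \<open>A\<close> itself (so that
  the size of \<open>A\<close> is part of the input even if \<open>B\<close> is empty), each terminated by the symbol \<open>3\<close>.\<close>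

definition instance_word :: "'a list \<Rightarrow> 'a set list \<Rightarrow> nat list" where
  "instance_word xs bs = concat (map (\<lambda>b. subset_word xs b @ [3]) (set xs # bs))"

end

theory Submission
  imports Defs
begin

text \<open>
  A subset of \<open>A\<close> is a compare set iff for all \<open>b \<not>\<subseteq> b'\<close> in \<open>B\<close> it contains an element of \<open>b - b'\<close>, so
  that compare sets are set covers: an element \<open>a\<close> covers the pairs \<open>(b, b')\<close> with \<open>a \<in> b - b'\<close>. There are
  at most \<open>(card B)\<^sup>2\<close> pairs, and the greedy algorithm finds a cover that is optimal up to the factor
  \<open>1 + ln ((card B)\<^sup>2)\<close>.

  Instead of searching for the best column, the Turing machine lowers a threshold \<open>t\<close> step by step to
  \<open>1\<close>, and for each \<open>t\<close> adds every column that covers at least \<open>t\<close> uncovered pairs when it is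
  considered. As no column covers more than \<open>t\<close> pairs at that stage, this is a greedy choice, and
  only counting up to \<open>t\<close> in unary is needed.
\<close>


section \<open>Greedy covers by decreasing thresholds\<close>

definition gain :: "(nat \<Rightarrow> 'e set) \<Rightarrow> nat set \<Rightarrow> nat \<Rightarrow> nat" where
  "gain S C c = card (S c - \<Union> (S ` C))"

primrec sweep :: "(nat \<Rightarrow> 'e set) \<Rightarrow> nat \<Rightarrow> nat set \<Rightarrow> nat \<Rightarrow> nat set" where
  "sweep S t C 0 = C"
| "sweep S t C (Suc c) =
     (if t \<le> gain S (sweep S t C c) c then insert c (sweep S t C c) else sweep S t C c)"

text \<open>After \<open>i\<close> steps the thresholds \<open>N\<close>, ...,
  \<open>N - i + 1\<close> have been swept, so \<open>greedy S m N N\<close> ends with threshold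
  1.\<close>

primrec greedy :: "(nat \<Rightarrow> 'e set) \<Rightarrow> nat \<Rightarrow> nat \<Rightarrow> nat \<Rightarrow> nat set" where
  "greedy S m N 0 = {}"
| "greedy S m N (Suc i) = sweep S (N - i) (greedy S m N i) m"

lemma sweep_subset: "sweep S t C c \<subseteq> C \<union> {..<c}"
  by (induction c) auto

lemma greedy_subset: "greedy S m N i \<subseteq> {..<m}"
  by (induction i) (use sweep_subset in fastforce)+

lemma finite_greedy: "finite (greedy S m N i)"
  using finite_subset[OF greedy_subset] by blast

lemma gain_antimono:
  assumes "C \<subseteq> D" "finite (S c)"
  shows "gain S D c \<le> gain S C c"
  unfolding gain_def using assms by (intro card_mono) auto

text \<open>A considered column is either rejected with gain below \<open>t\<close> or added, which
  makes its gain 0; later insertions only lower the gain.\<close>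

lemma gain_sweep:
  assumes "\<And>c. finite (S c)" "0 < t" "c < k"
  shows "gain S (sweep S t C k) c < t"
  using \<open>c < k\<close>
proof (induction k)
  case (Suc k)
  let ?D = "sweep S t C k"
  show ?case
  proof (cases "c = k")
    case True
    have "gain S (insert k ?D) k = 0"
      by (simp add: gain_def Diff_eq_empty_iff[THEN iffD2])
    with True show ?thesis using \<open>0 < t\<close> by simp
  next
    case False
    then have "gain S ?D c < t"
      using Suc by simp
    moreover have "gain S (sweep S t C (Suc k)) c \<le> gain S ?D c"
      by (intro gain_antimono) (auto simp: assms(1))
    ultimately show ?thesis by linarith
  qed
qed simp

text \<open>Each addition raises the first summand by \<open>t\<close> and removes at least
  \<open>t\<close> uncovered elements.\<close>

lemma sweep_charge:
  fixes S :: "nat \<Rightarrow> 'e set"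
  assumes "\<And>c. finite (S c)" "0 < t" "finite C" "k \<le> m"
  defines "U \<equiv> \<Union> (S ` {..<m})"
  shows "t * card (sweep S t C k) + card (U - \<Union> (S ` sweep S t C k))
       \<le> t * card C + card (U - \<Union> (S ` C))"
  using \<open>k \<le> m\<close>
proof (induction k)
  case (Suc k)
  let ?D = "sweep S t C k"
  have fin: "finite ?D"
    using finite_subset[OF sweep_subset[of S t C k]] \<open>finite C\<close> by simp
  show ?case
  proof (cases "t \<le> gain S ?D k")
    case True
    then have "k \<notin> ?D"
      using \<open>0 < t\<close> by (auto simp: gain_def Diff_eq_empty_iff[THEN iffD2] UN_upper)
    have sub: "S k - \<Union> (S ` ?D) \<subseteq> U - \<Union> (S ` ?D)"
      using Suc.prems by (auto simp: U_def)
    have eq: "U - \<Union> (S ` insert k ?D) = (U - \<Union> (S ` ?D)) - (S k - \<Union> (S ` ?D))"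
      by auto
    have "finite U"
      using assms(1) by (simp add: U_def)
    have "card (U - \<Union> (S ` insert k ?D)) = card (U - \<Union> (S ` ?D)) - gain S ?D k"
      unfolding eq gain_def using sub assms(1) by (intro card_Diff_subset) auto
    moreover have "gain S ?D k \<le> card (U - \<Union> (S ` ?D))"
      unfolding gain_def using sub \<open>finite U\<close> by (intro card_mono) auto
    ultimately show ?thesis
      using True \<open>k \<notin> ?D\<close> fin Suc by simp
  qed (use Suc in simp)
qed simp

text \<open>The cover \<open>P\<close> also covers what \<open>C\<close> misses, and each of its
  columns accounts for at most \<open>t\<close> of that.\<close>

lemma uncovered_le:
  assumes "\<And>c. finite (S c)" "finite P" "\<Union> (S ` P) = U" "\<And>c. c \<in> P \<Longrightarrow> gain S C c \<le> t"
  shows "card (U - \<Union> (S ` C)) \<le> card P * t"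
proof -
  have "U - \<Union> (S ` C) = (\<Union>c\<in>P. S c - \<Union> (S ` C))"
    using assms(3) by auto
  then have "card (U - \<Union> (S ` C)) \<le> (\<Sum>c\<in>P. card (S c - \<Union> (S ` C)))"
    by (simp only: card_UN_le[OF \<open>finite P\<close>])
  also have "\<dots> \<le> (\<Sum>c\<in>P. t)"
    using assms(4) by (intro sum_mono) (simp add: gain_def)
  finally show ?thesis by simp
qed

lemma gain_greedy:
  assumes "\<And>c. finite (S c)" "\<And>c. card (S c) \<le> N" "i \<le> N" "c < m"
  shows "gain S (greedy S m N i) c \<le> N - i"
proof (cases i)
  case 0
  then show ?thesis using assms by (simp add: gain_def)
next
  case (Suc j)
  then have "gain S (greedy S m N i) c < N - j"
    using gain_sweep[of S "N - j" c m] assms by simp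
  then show ?thesis using Suc by simp
qed

text \<open>While the threshold is \<open>t\<close>, adding a column costs \<open>1\<close> and lowers \<open>card (uncovered) / t\<close> by at least \<open>1\<close>.
  Lowering the threshold to \<open>t - 1\<close> raises the latter by at most \<open>card P / t\<close>, because then at most
  \<open>card P * (t - 1)\<close> pairs are uncovered; these increments sum up to the logarithm.\<close>

lemma greedy_potential:
  fixes S :: "nat \<Rightarrow> 'e set"
  assumes fin: "\<And>c. finite (S c)" and N: "\<And>c. card (S c) \<le> N"
    and P: "P \<subseteq> {..<m}" "\<Union> (S ` P) = \<Union> (S ` {..<m})"
    and "i < N"
  defines "U \<equiv> \<Union> (S ` {..<m})"
  shows "(card U \<le> N - i \<longrightarrow> greedy S m N i = {}) \<and>
    (N - i \<le> card U \<longrightarrow>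
      card (greedy S m N i) + card (U - \<Union> (S ` greedy S m N i)) / real (N - i)
        \<le> card P * (1 + ln (card U) - ln (real (N - i))))"
  using \<open>i < N\<close>
proof (induction i)
  case 0
  have "finite P"
    using P finite_subset by blast
  have "card U \<le> card P * N"
    using uncovered_le[of S P U "{}" N] fin N \<open>finite P\<close> P by (simp add: U_def gain_def)
  then have "real (card U) \<le> card P * real N"
    by (metis of_nat_le_iff of_nat_mult)
  then have "card U / real N \<le> card P"
    using 0 by (simp add: field_simps)
  moreover have "0 \<le> card P * (ln (card U) - ln N)" if "N \<le> card U"
    using that 0 by simp
  ultimately show ?case
    by (auto simp: algebra_simps)
next
  case (Suc i)
  let ?t = "N - Suc i"
  let ?C = "greedy S m N i" and ?D = "greedy S m N (Suc i)"
  let ?r = "\<lambda>C. card (U - \<Union> (S ` C))"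
  have t: "N - i = Suc ?t" "0 < ?t"
    using Suc.prems by auto
  have "finite P"
    using P finite_subset by blast
  have charge: "Suc ?t * card ?D + ?r ?D \<le> Suc ?t * card ?C + ?r ?C"
    using sweep_charge[of S "Suc ?t" ?C m m, OF fin _ finite_greedy] t by (simp add: U_def)
  have "?r ?D \<le> card P * ?t"
    using P Suc.prems
    by (intro uncovered_le fin \<open>finite P\<close> gain_greedy N) (auto simp: U_def)
  then have r: "real (?r ?D) \<le> card P * real ?t"
    by (metis of_nat_le_iff of_nat_mult)
  \<comment> \<open>A threshold above \<open>card U\<close> adds nothing: a single new column would
    cost \<open>Suc ?t\<close>, more than the uncovered elements can pay.\<close>
  have empty: "?D = {}" if "card U \<le> ?t"
  proof -
    have "?C = {}"
      using Suc that t by simp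
    then have "Suc ?t * card ?D \<le> ?t"
      using charge that by simp
    then have "card ?D = 0"
      by (cases "card ?D") auto
    then show ?thesis
      using finite_greedy card_0_eq by metis
  qed
  \<comment> \<open>If \<open>?t = card U\<close>, nothing has been chosen yet, the logarithms
    cancel and \<open>r\<close> suffices. Otherwise \<open>Suc ?t\<close> is at most
    \<open>card U\<close> too, and the induction hypothesis applies.\<close>
  moreover have "card ?D + ?r ?D / ?t \<le> card P * (1 + ln (card U) - ln ?t)" if "?t \<le> card U"
  proof (cases "?t = card U")
    case True
    then show ?thesis
      using empty r t by (simp add: field_simps)
  next
    case False
    then have IH: "card ?C + ?r ?C / Suc ?t \<le> card P * (1 + ln (card U) - ln (Suc ?t))"
      using Suc that t by simp
    have scale: "a + b / z \<le> c + d / z" if "z * a + b \<le> z * c + d" "0 < z" for a b c d z :: real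
      using divide_right_mono[OF that(1), of z] that(2) by (simp add: add_divide_distrib)
    have "real (Suc ?t * card ?D + ?r ?D) \<le> real (Suc ?t * card ?C + ?r ?C)"
      using charge by (simp only: of_nat_le_iff)
    then have 1: "card ?D + ?r ?D / Suc ?t \<le> card ?C + ?r ?C / Suc ?t"
      by (intro scale) (simp_all only: of_nat_add of_nat_mult of_nat_0_less_iff zero_less_Suc)
    \<comment> \<open>The change of denominator costs at most \<open>card P / Suc ?t\<close> by
      \<open>r\<close>; then \<open>ln x \<le> x - 1\<close> at \<open>x = ?t / Suc ?t\<close>
      compares this with the growth of the logarithm.\<close>
    have "?r ?D / ?t - ?r ?D / Suc ?t = ?r ?D / ?t * (1 / Suc ?t)"
      using t by (simp add: field_simps del: greedy.simps)
    also have "\<dots> \<le> card P * (1 / Suc ?t)"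
      using r t by (intro mult_right_mono) (auto simp: field_simps)
    also have "\<dots> \<le> card P * (ln (Suc ?t) - ln ?t)"
    proof (intro mult_left_mono)
      have "ln (?t / Suc ?t) \<le> ?t / Suc ?t - 1"
        using t by (intro ln_le_minus_one) simp
      also have "\<dots> = - (1 / Suc ?t)"
        by (simp add: field_simps)
      finally show "1 / Suc ?t \<le> ln (Suc ?t) - ln ?t"
        using t by (simp add: ln_div)
    qed simp
    finally show ?thesis
      using 1 IH by (simp add: algebra_simps del: greedy.simps)
  qed
  ultimately show ?case by blast
qed

theorem greedy_approx:
  fixes S :: "nat \<Rightarrow> 'e set"
  assumes fin: "\<And>c. finite (S c)" and N: "\<And>c. card (S c) \<le> N" "0 < N"
    and P: "P \<subseteq> {..<m}" "\<Union> (S ` P) = \<Union> (S ` {..<m})"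
  defines "U \<equiv> \<Union> (S ` {..<m})"
  shows "\<Union> (S ` greedy S m N N) = U"
    and "card (greedy S m N N) \<le> card P * (1 + ln (card U))"
proof -
  let ?D = "greedy S m N N" and ?C = "greedy S m N (N - 1)"
  have "finite U"
    using fin by (simp add: U_def)
  have "S c \<subseteq> \<Union> (S ` ?D)" if "c < m" for c
    using gain_greedy[of S N N c m] that fin N by (auto simp: gain_def)
  then have "U \<subseteq> \<Union> (S ` ?D)"
    unfolding U_def by blast
  then show "\<Union> (S ` ?D) = U"
    using greedy_subset[of S m N N] by (auto simp: U_def)
  have "Suc (N - 1) = N" "N - (N - 1) = 1"
    using N by auto
  then have "?D = sweep S 1 ?C m"
    by (metis greedy.simps(2))
  then have charge: "card ?D \<le> card ?C + card (U - \<Union> (S ` ?C))"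
    using sweep_charge[of S 1 ?C m m, OF fin _ finite_greedy] by (simp add: U_def)
  \<comment> \<open>At threshold 1 the division disappears and \<open>ln 1 = 0\<close>. The first
    conjunct serves the case \<open>card U = 0\<close>.\<close>
  have pot: "(card U \<le> 1 \<longrightarrow> ?C = {}) \<and> (1 \<le> card U \<longrightarrow>
      card ?C + real (card (U - \<Union> (S ` ?C))) \<le> card P * (1 + ln (card U)))"
    using greedy_potential[OF fin N(1) P, of "N - 1"] N \<open>N - (N - 1) = 1\<close> by (simp add: U_def)
  show "card ?D \<le> card P * (1 + ln (card U))"
  proof (cases "card U = 0")
    case True
    then show ?thesis
      using pot charge \<open>finite U\<close> by simp
  next
    case False
    then have "card ?C + real (card (U - \<Union> (S ` ?C))) \<le> card P * (1 + ln (card U))"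
      using pot by simp
    moreover have "real (card ?D) \<le> card ?C + real (card (U - \<Union> (S ` ?C)))"
      using charge by linarith
    ultimately show ?thesis by linarith
  qed
qed


section \<open>Runs of Turing machines\<close>

text \<open>An upper bound on the number of steps, so that the bounds of consecutive phases add up
  and can be rounded up.\<close>

definition reaches :: "tm \<Rightarrow> config \<Rightarrow> nat \<Rightarrow> config \<Rightarrow> bool" where
  "reaches M c t c' \<longleftrightarrow> (\<exists>s\<le>t. (tm_step M ^^ s) c = c')"

lemma reaches_step: "tm_step M c = c' \<Longrightarrow> reaches M c 1 c'"
  unfolding reaches_def by (intro exI[of _ 1]) simp

lemma reaches_trans [trans]:
  assumes "reaches M c s c'" "reaches M c' t c''"
  shows "reaches M c (s + t) c''"
proof -
  from assms obtain s' t' where "s' \<le> s" "(tm_step M ^^ s') c = c'"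
    "t' \<le> t" "(tm_step M ^^ t') c' = c''"
    unfolding reaches_def by blast
  then have "s' + t' \<le> s + t \<and> (tm_step M ^^ (t' + s')) c = c''"
    by (simp add: funpow_add)
  then show ?thesis
    unfolding reaches_def by (metis add.commute)
qed

lemma reaches_mono: "reaches M c s c' \<Longrightarrow> s \<le> t \<Longrightarrow> reaches M c t c'"
  unfolding reaches_def using order_trans by blast

lemma reaches_loop:
  assumes "\<And>i. i < n \<Longrightarrow> reaches M (f i) t (f (Suc i))"
  shows "reaches M (f 0) (n * t) (f n)"
  using assms
proof (induction n)
  case 0
  then show ?case by (auto simp: reaches_def intro: exI[of _ 0])
next
  case (Suc n)
  then have "reaches M (f 0) (n * t + t) (f (Suc n))"
    by (intro reaches_trans[of M "f 0" "n * t" "f n"]) auto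
  then show ?case by (simp add: add.commute)
qed

lemma tm_step_halted: "(tm_step M ^^ k) (n_states M, ts) = (n_states M, ts)"
  by (induction k) (auto simp: tm_step_def)

text \<open>Halting configurations are fixed points, so an upper bound yields the exact step count
  in \<open>tm_outputs_within\<close>.\<close>

lemma reaches_halted:
  assumes "reaches M c t (n_states M, ts)"
  shows "(tm_step M ^^ t) c = (n_states M, ts)"
proof -
  obtain s where s: "s \<le> t" "(tm_step M ^^ s) c = (n_states M, ts)"
    using assms by (auto simp: reaches_def)
  have "(tm_step M ^^ (t - s + s)) c = (n_states M, ts)"
    unfolding funpow_add using s by (simp add: tm_step_halted)
  then show ?thesis using s by simp
qed

text \<open>A pass runs through all pairs \<open>(p, q)\<close> of positions of tapes \<open>1\<close> and \<open>2\<close>; \<open>body\<close> gives the symbol to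
  write on tape \<open>5\<close>, which then advances, and the action on tape \<open>6\<close>.\<close>

definition pass_code ::
  "nat \<Rightarrow> (nat list \<Rightarrow> nat \<times> nat \<times> int) \<Rightarrow> (nat list \<Rightarrow> nat \<times> (nat \<times> int) list) list" where
  "pass_code s body =
    [\<lambda>rs. if rs ! 1 \<noteq> 0 then (s + 1, zip rs [0, 0, 0, 0, 0, 0, 0])
          else (s + 3, zip rs [0, -1, 0, -1, 0, -1, 0]),
     \<lambda>rs. if rs ! 2 \<noteq> 0
          then (s + 1, zip (take 5 rs) [0, 0, 1, 0, 1] @ [(fst (body rs), 1), snd (body rs)])
          else (s + 2, zip rs [0, 0, -1, 0, -1, 0, 0]),
     \<lambda>rs. if rs ! 2 \<noteq> 0 then (s + 2, zip rs [0, 0, -1, 0, -1, 0, 0])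
          else (s, zip rs [0, 1, 1, 1, 1, 0, 0]),
     \<lambda>rs. if rs ! 1 \<noteq> 0 then (s + 3, zip rs [0, -1, 0, -1, 0, 0, 0])
          else (s + 4, zip rs [0, 1, 0, 1, 0, 0, 0]),
     \<lambda>rs. if rs ! 5 \<noteq> 0 then (s + 4, zip rs [0, 0, 0, 0, 0, -1, 0])
          else (s + 5, zip rs [0, 0, 0, 0, 0, 1, 0])]"

lemma act_read_tape: "act_tape (read_tape \<tau>, 0) \<tau> = \<tau>"
  by (cases \<tau>) (simp add: act_tape_def read_tape_def)

lemma read_tape_Pair [simp]: "read_tape (c, h) = c h"
  by (simp add: read_tape_def)

lemma act_tape_Pair [simp]: "act_tape (s, d) (c, h) = (c(h := s), h + d)"
  by (simp add: act_tape_def)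

text \<open>Each position of tape 1 costs a step in, \<open>L\<close> body steps, a turn,
  \<open>L\<close> steps back and a step out; the rest rewinds tapes 1, 3 and 5.\<close>

definition pass_time :: "nat \<Rightarrow> nat" where
  "pass_time L = L * (2 * L + 3) + (1 + L + 1 + L * L + 1)"

text \<open>\<open>u k\<close> and \<open>\<tau> k\<close> describe tapes 5 and 6 before the pair
  with index \<open>k = p * L + q\<close>; the hypothesis on \<open>body\<close> advances them by
  one pair. Those on \<open>w\<close> and the final \<open>u\<close> ensure that blanks mark the
  ends where heads turn.\<close>

lemma pass_reaches:
  fixes w :: "int \<Rightarrow> nat" and u :: "nat \<Rightarrow> int \<Rightarrow> nat" and \<tau> :: "nat \<Rightarrow> tape"
  assumes code: "\<And>j. j < 5 \<Longrightarrow> delta M (s + j) = pass_code s body ! j"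
    and s: "s + 5 \<le> n_states M"
    and w: "\<And>i. w i \<noteq> 0 \<longleftrightarrow> 0 \<le> i \<and> i < int L"
    and body: "\<And>p q k. p < L \<Longrightarrow> q < L \<Longrightarrow> k = p * L + q \<Longrightarrow>
      (case body [x h, w (int p), w (int q), w (int p + d), w (int q + d),
                  u k (int k), read_tape (\<tau> k)] of
        (y, a) \<Rightarrow> u (Suc k) = (u k)(int k := y) \<and> \<tau> (Suc k) = act_tape a (\<tau> k))"
    and u: "\<And>i. u (L * L) i \<noteq> 0 \<longleftrightarrow> 0 \<le> i \<and> i < int (L * L)"
  shows "reaches M (s, [(x, h), (w, 0), (w, 0), (w, d), (w, d), (u 0, 0), \<tau> 0]) (pass_time L)
    (s + 5, [(x, h), (w, 0), (w, 0), (w, d), (w, d), (u (L * L), 0), \<tau> (L * L)])"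
proof -
  have step: "tm_step M (s + j, ts) =
      (case (pass_code s body ! j) (map read_tape ts) of (q', acts) \<Rightarrow> (q', map2 act_tape acts ts))"
    if "j < 5" for j ts
    using code[OF that] s that by (simp add: tm_step_def)
  note step = step[of 0, simplified] step[of 1, simplified] step[of 2, simplified]
    step[of 3, simplified] step[of 4, simplified]
  note sim = step pass_code_def act_read_tape fun_upd_idem
  \<comment> \<open>The position \<open>q\<close> is an integer because rewinding ends on the blank
    cell -1.\<close>
  let ?in = "\<lambda>j p q k. (j, [(x, h), (w, int p), (w, q), (w, int p + d), (w, q + d),
    (u k, int k), \<tau> k])"
  have outer: "reaches M (?in s p 0 (p * L)) (2 * L + 3) (?in s (Suc p) 0 (Suc p * L))"
    if "p < L" for p
  proof -
    have "reaches M (?in s p 0 (p * L)) 1 (?in (s + 1) p (int 0) (p * L + 0))"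
      using that w[of "int p"] by (intro reaches_step) (simp add: sim)
    also have "reaches M (?in (s + 1) p (int 0) (p * L + 0)) (L * 1)
       (?in (s + 1) p (int L) (p * L + L))"
    proof (rule reaches_loop[of L M "\<lambda>q. ?in (s + 1) p (int q) (p * L + q)"])
      fix q assume "q < L"
      then show "reaches M (?in (s + 1) p (int q) (p * L + q)) 1
          (?in (s + 1) p (int (Suc q)) (p * L + Suc q))"
        using body[OF \<open>p < L\<close> \<open>q < L\<close> refl] w[of "int q"]
        by (intro reaches_step) (auto simp: sim split: prod.splits)
    qed
    also have "reaches M (?in (s + 1) p (int L) (p * L + L)) 1
        (?in (s + 2) p (int L - 1 - int 0) (Suc p * L))"
      using w[of "int L"] by (intro reaches_step) (simp add: sim algebra_simps)
    also have "reaches M (?in (s + 2) p (int L - 1 - int 0) (Suc p * L)) (L * 1)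
        (?in (s + 2) p (int L - 1 - int L) (Suc p * L))"
    proof (rule reaches_loop[of L M "\<lambda>q. ?in (s + 2) p (int L - 1 - int q) (Suc p * L)"])
      fix q assume "q < L"
      then show "reaches M (?in (s + 2) p (int L - 1 - int q) (Suc p * L)) 1
          (?in (s + 2) p (int L - 1 - int (Suc q)) (Suc p * L))"
        using w[of "int L - 1 - int q"] by (intro reaches_step) (simp add: sim)
    qed
    also have "reaches M (?in (s + 2) p (int L - 1 - int L) (Suc p * L)) 1
        (?in s (Suc p) 0 (Suc p * L))"
      using w[of "-1"] by (intro reaches_step) (simp add: sim)
    finally show ?thesis
      by (rule reaches_mono) simp
  qed
  let ?ex = "\<lambda>j p k. (j, [(x, h), (w, p), (w, 0), (w, p + d), (w, d), (u (L * L), k), \<tau> (L * L)])"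
  have "reaches M (?in s 0 0 (0 * L)) (L * (2 * L + 3)) (?in s L 0 (L * L))"
    using reaches_loop[of L M "\<lambda>p. ?in s p 0 (p * L)", OF outer] by simp
  also have "reaches M (?in s L 0 (L * L)) 1 (?ex (s + 3) (int L - 1 - int 0) (int (L * L) - 1))"
    using w[of "int L"] by (intro reaches_step) (simp add: sim)
  also have "reaches M (?ex (s + 3) (int L - 1 - int 0) (int (L * L) - 1)) (L * 1)
      (?ex (s + 3) (int L - 1 - int L) (int (L * L) - 1))"
  proof (rule reaches_loop[of L M "\<lambda>i. ?ex (s + 3) (int L - 1 - int i) (int (L * L) - 1)"])
    fix i assume "i < L"
    then show "reaches M (?ex (s + 3) (int L - 1 - int i) (int (L * L) - 1)) 1
        (?ex (s + 3) (int L - 1 - int (Suc i)) (int (L * L) - 1))"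
      using w[of "int L - 1 - int i"] by (intro reaches_step) (simp add: sim)
  qed
  also have "reaches M (?ex (s + 3) (int L - 1 - int L) (int (L * L) - 1)) 1
      (?ex (s + 4) 0 (int (L * L) - 1 - int 0))"
    using w[of "-1"] by (intro reaches_step) (simp add: sim)
  also have "reaches M (?ex (s + 4) 0 (int (L * L) - 1 - int 0)) (L * L * 1)
      (?ex (s + 4) 0 (int (L * L) - 1 - int (L * L)))"
  proof (rule reaches_loop[of "L * L" M "\<lambda>i. ?ex (s + 4) 0 (int (L * L) - 1 - int i)"])
    fix i assume "i < L * L"
    then have "u (L * L) (int (L * L) - 1 - int i) \<noteq> 0"
      unfolding u by linarith
    then show "reaches M (?ex (s + 4) 0 (int (L * L) - 1 - int i)) 1
        (?ex (s + 4) 0 (int (L * L) - 1 - int (Suc i)))"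
      by (intro reaches_step) (simp add: sim)
  qed
  also have "reaches M (?ex (s + 4) 0 (int (L * L) - 1 - int (L * L))) 1 (?ex (s + 5) 0 0)"
    using u[of "-1"] by (intro reaches_step) (simp add: sim)
  finally show ?thesis
    by (simp add: pass_time_def add.assoc)
qed


section \<open>The machine\<close>

text \<open>Tapes 1 and 2 are at row ends; in the rows after them, tapes 3 and 4 see the current
  column present and absent, respectively; the mark on tape 5 says that the pair is not yet
  covered.\<close>

definition uncovered_pair :: "nat list \<Rightarrow> bool" where
  "uncovered_pair rs \<longleftrightarrow> rs ! 1 = 3 \<and> rs ! 2 = 3 \<and> rs ! 3 = 2 \<and> rs ! 4 = 1 \<and> rs ! 5 = 1"

text \<open>One unary digit is written per pair, so that the first threshold is
  \<open>L * L\<close>.\<close>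

definition init_body :: "nat list \<Rightarrow> nat \<times> nat \<times> int" where
  "init_body rs = (1, 1, -1)"

definition count_body :: "nat list \<Rightarrow> nat \<times> nat \<times> int" where
  "count_body rs = (rs ! 5, rs ! 6, if uncovered_pair rs \<and> rs ! 6 \<noteq> 0 then 1 else 0)"

definition update_body :: "nat list \<Rightarrow> nat \<times> nat \<times> int" where
  "update_body rs = (if uncovered_pair rs then 2 else rs ! 5, rs ! 6, 0)"

text \<open>While tapes 1 to 4 receive the input, tape 0 is overwritten by \<open>y\<close>: 1 along
  the first row, then blanks, which leaves the empty solution.\<close>

definition copy_act :: "nat \<Rightarrow> nat list \<Rightarrow> (nat \<times> int) list" where
  "copy_act y rs = zip [y, rs ! 0, rs ! 0, rs ! 0, rs ! 0, rs ! 5, rs ! 6] [1, 1, 1, 1, 1, 0, 0]"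

text \<open>
  Tape \<open>0\<close> holds the characteristic vector of the current solution, with its head on the column
  \<open>c\<close> under consideration. Tapes \<open>1\<close>--\<open>4\<close> are copies of the input with heads at \<open>p\<close>, \<open>q\<close>, \<open>p + c + 1\<close>
  and \<open>q + c + 1\<close>: if \<open>p\<close> is the end of a row, then the head of tape \<open>3\<close> sees column \<open>c\<close> of the next
  row, and the row of \<open>A\<close> is never seen that way. Tape \<open>5\<close> has at position \<open>p * L + q\<close>, where \<open>L\<close> is the
  length of the input, the symbol \<open>2\<close> if the pair \<open>(p, q)\<close> is covered and \<open>1\<close> otherwise. Tape \<open>6\<close> has \<open>t\<close>
  ones for the current threshold \<open>t\<close>, at the positions \<open>1 - t, \<dots>, 0\<close>; counting up to \<open>t\<close> is moving right
  until the blank at position \<open>1\<close>.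

  States \<open>0\<close>--\<open>8\<close> set up the tapes, \<open>9\<close> is the loop over the thresholds \<open>L * L, \<dots>, 1\<close> and \<open>10\<close> the loop
  over the columns; \<open>11\<close>--\<open>16\<close> count the pairs gained by a column, \<open>17\<close>--\<open>22\<close> add it to the solution.
\<close>

definition code :: "(nat list \<Rightarrow> nat \<times> (nat \<times> int) list) list" where
  "code =
    [\<lambda>rs. if rs ! 0 \<noteq> 3 then (0, copy_act 1 rs) else (1, zip rs [0, 0, 0, 0, 0, 0, 0]),
     \<lambda>rs. if rs ! 0 \<noteq> 0 then (1, copy_act 0 rs) else (2, zip rs [-1, -1, -1, -1, -1, 0, 0]),
     \<lambda>rs. if rs ! 1 \<noteq> 0 then (2, zip rs [-1, -1, -1, -1, -1, 0, 0])
          else (3, zip rs [1, 1, 1, 1, 1, 0, 0])]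
    @ pass_code 3 init_body @
    [\<lambda>rs. (9, zip rs [0, 0, 0, 1, 1, 0, 1]),
     \<lambda>rs. if rs ! 6 \<noteq> 0 then (10, zip rs [0, 0, 0, 0, 0, 0, 0])
          else (25, zip rs [0, 0, 0, 0, 0, 0, 0]),
     \<lambda>rs. if rs ! 0 \<noteq> 0 then (11, zip rs [0, 0, 0, 0, 0, 0, 0])
          else (24, zip rs [-1, 0, 0, -1, -1, 0, 0])]
    @ pass_code 11 count_body @
    [\<lambda>rs. if rs ! 6 = 0 then (17, zip rs [0, 0, 0, 0, 0, 0, 0])
          else (23, zip rs [0, 0, 0, 0, 0, 0, -1])]
    @ pass_code 17 update_body @
    [\<lambda>rs. (23, (2, 0) # zip (tl rs) [0, 0, 0, 0, 0, -1]),
     \<lambda>rs. if rs ! 6 \<noteq> 0 then (23, zip rs [0, 0, 0, 0, 0, 0, -1])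
          else (10, zip rs [1, 0, 0, 1, 1, 0, 1]),
     \<lambda>rs. if rs ! 0 \<noteq> 0 then (24, zip rs [-1, 0, 0, -1, -1, 0, 0])
          else (9, zip (butlast rs) [1, 0, 0, 1, 1, 0] @ [(0, 1)])]"

definition machine :: tm where
  "machine = \<lparr>n_tapes = 7, n_states = 25, n_symbols = 4, delta = \<lambda>q. code ! q\<rparr>"

lemma less_5_cases: "(j::nat) < 5 \<Longrightarrow> j = 0 \<or> j = 1 \<or> j = 2 \<or> j = 3 \<or> j = 4"
  by linarith

lemma length_code: "length code = 25"
  by (simp add: code_def pass_code_def)

lemma code_nth:
  "code ! 0 = (\<lambda>rs. if rs ! 0 \<noteq> 3 then (0, copy_act 1 rs) else (1, zip rs [0, 0, 0, 0, 0, 0, 0]))"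
  "code ! Suc 0 = (\<lambda>rs. if rs ! 0 \<noteq> 0 then (1, copy_act 0 rs) else (2, zip rs [-1, -1, -1, -1, -1, 0, 0]))"
  "code ! 2 = (\<lambda>rs. if rs ! 1 \<noteq> 0 then (2, zip rs [-1, -1, -1, -1, -1, 0, 0])
          else (3, zip rs [1, 1, 1, 1, 1, 0, 0]))"
  "code ! 8 = (\<lambda>rs. (9, zip rs [0, 0, 0, 1, 1, 0, 1]))"
  "code ! 9 = (\<lambda>rs. if rs ! 6 \<noteq> 0 then (10, zip rs [0, 0, 0, 0, 0, 0, 0])
          else (25, zip rs [0, 0, 0, 0, 0, 0, 0]))"
  "code ! 10 = (\<lambda>rs. if rs ! 0 \<noteq> 0 then (11, zip rs [0, 0, 0, 0, 0, 0, 0])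
          else (24, zip rs [-1, 0, 0, -1, -1, 0, 0]))"
  "code ! 16 = (\<lambda>rs. if rs ! 6 = 0 then (17, zip rs [0, 0, 0, 0, 0, 0, 0])
          else (23, zip rs [0, 0, 0, 0, 0, 0, -1]))"
  "code ! 22 = (\<lambda>rs. (23, (2, 0) # zip (tl rs) [0, 0, 0, 0, 0, -1]))"
  "code ! 23 = (\<lambda>rs. if rs ! 6 \<noteq> 0 then (23, zip rs [0, 0, 0, 0, 0, 0, -1])
          else (10, zip rs [1, 0, 0, 1, 1, 0, 1]))"
  "code ! 24 = (\<lambda>rs. if rs ! 0 \<noteq> 0 then (24, zip rs [-1, 0, 0, -1, -1, 0, 0])
          else (9, zip (butlast rs) [1, 0, 0, 1, 1, 0] @ [(0, 1)]))"
  by (simp_all add: code_def pass_code_def)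

lemma code_pass:
  assumes "j < 5"
  shows "code ! (3 + j) = pass_code 3 init_body ! j"
    and "code ! (11 + j) = pass_code 11 count_body ! j"
    and "code ! (17 + j) = pass_code 17 update_body ! j"
  using less_5_cases[OF assms] by (elim disjE; simp add: code_def pass_code_def)+

lemma turing_machine_machine: "turing_machine machine"
proof -
  have "case (code ! q) rs of (q', acts) \<Rightarrow>
      q' \<le> 25 \<and> length acts = 7 \<and> set acts \<subseteq> {..<4} \<times> {-1, 0, 1}"
    if q: "q < 25" and len: "length rs = 7" and sym: "set rs \<subseteq> {..<4}" for q rs
  proof -
    obtain r0 r1 r2 r3 r4 r5 r6 where rs: "rs = [r0, r1, r2, r3, r4, r5, r6]"
      using len by (auto simp: eval_nat_numeral length_Suc_conv)
    have r: "r0 < 4" "r1 < 4" "r2 < 4" "r3 < 4" "r4 < 4" "r5 < 4" "r6 < 4"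
      using sym by (auto simp: rs)
    have "list_all (\<lambda>f. case f rs of (q', acts) \<Rightarrow>
      q' \<le> 25 \<and> length acts = 7 \<and> set acts \<subseteq> {..<4} \<times> {-1, 0, 1}) code"
      unfolding code_def pass_code_def append_Cons append_Nil list.pred_inject
      by (intro conjI; simp add: r rs init_body_def count_body_def update_body_def copy_act_def)
    then show ?thesis
      using q length_code by (simp add: list_all_length)
  qed
  then show ?thesis
    by (simp add: turing_machine_def machine_def)
qed

lemma machine_simps [simp]: "n_states machine = 25" "n_tapes machine = 7"
  "delta machine q = code ! q"
  by (simp_all add: machine_def)

lemma step_machine:
  assumes "q < 25"
  shows "tm_step machine (q, ts) =
    (case (code ! q) (map read_tape ts) of (q', acts) \<Rightarrow> (q', map2 act_tape acts ts))"
  using assms by (simp add: tm_step_def)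

lemmas machine_sim = step_machine code_nth copy_act_def fun_upd_idem

section \<open>Tape contents and the simulation of the greedy algorithm\<close>

definition cover :: "nat \<Rightarrow> (int \<Rightarrow> nat) \<Rightarrow> nat \<Rightarrow> nat set" where
  "cover L w c = {k. k < L * L \<and> w (int (k div L)) = 3 \<and> w (int (k mod L)) = 3 \<and>
     w (int (k div L) + (1 + int c)) = 2 \<and> w (int (k mod L) + (1 + int c)) = 1}"

definition char_tape :: "nat \<Rightarrow> nat set \<Rightarrow> int \<Rightarrow> nat" where
  "char_tape n D = (\<lambda>i. if 0 \<le> i \<and> i < int n then if nat i \<in> D then 2 else 1 else 0)"

definition unary_tape :: "nat \<Rightarrow> int \<Rightarrow> nat" where
  "unary_tape t = (\<lambda>i. if - int t < i \<and> i \<le> 0 then 1 else 0)"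

lemma char_tape_update:
  assumes "k < n"
  shows "char_tape n (insert k D) = (char_tape n D)(int k := 2)"
  using assms by (auto simp: char_tape_def fun_eq_iff)

lemma pair_index:
  fixes p q k L :: nat
  assumes "p < L" "q < L" "k = p * L + q"
  shows "k div L = p" "k mod L = q" "k < L * L"
proof -
  show "k div L = p" "k mod L = q"
    using assms by auto
  have "Suc p * L \<le> L * L"
    using assms by (intro mult_le_mono1) simp
  then show "k < L * L"
    using assms by simp
qed

text \<open>The configuration between steps of the main loops: tape 5 marks the pairs covered by
  \<open>C\<close>, and the head of tape 6 is on the leftmost one, or on a blank if
  \<open>t = 0\<close>. \<open>c\<close> is an integer because rewinding passes -1.\<close>

definition col_config ::
  "nat \<Rightarrow> nat \<Rightarrow> (int \<Rightarrow> nat) \<Rightarrow> nat \<Rightarrow> nat \<Rightarrow> nat set \<Rightarrow> int \<Rightarrow> config" where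
  "col_config L m w q t C c = (q, [(char_tape m C, c), (w, 0), (w, 0), (w, 1 + c), (w, 1 + c),
     (char_tape (L * L) (\<Union> (cover L w ` C)), 0), (unary_tape t, 1 - int t)])"

definition col_time :: "nat \<Rightarrow> nat" where
  "col_time L = 2 * pass_time L + L * L + 10"

definition round_time :: "nat \<Rightarrow> nat \<Rightarrow> nat" where
  "round_time L m = m * col_time L + m + 3"

context
  fixes L m :: nat and w :: "int \<Rightarrow> nat"
  assumes w: "\<And>i. w i \<noteq> 0 \<longleftrightarrow> 0 \<le> i \<and> i < int L"
begin

lemma uncovered_pair_iff:
  assumes "p < L" "q < L" "k = p * L + q"
  shows "uncovered_pair [y, w (int p), w (int q), w (int p + (1 + int c)), w (int q + (1 + int c)),
      char_tape (L * L) D (int k), z] \<longleftrightarrow> k \<in> cover L w c - D"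
proof -
  have "int k < int L * int L"
    using pair_index(3)[OF assms] by (metis of_nat_less_iff of_nat_mult)
  then show ?thesis
    using pair_index[OF assms] by (auto simp: uncovered_pair_def cover_def char_tape_def)
qed

text \<open>The head of tape 6 ends one cell to the left of its \<open>L * L\<close> ones; state 8
  corrects this.\<close>

lemma init_pass:
  "reaches machine (3, [(x, h), (w, 0), (w, 0), (w, 0), (w, 0), (\<lambda>_. 0, 0), (\<lambda>_. 0, 0)])
    (pass_time L)
    (8, [(x, h), (w, 0), (w, 0), (w, 0), (w, 0), (char_tape (L * L) {}, 0),
         (unary_tape (L * L), - int (L * L))])"
proof -
  have z: "char_tape 0 {} = (\<lambda>_. 0)" "unary_tape 0 = (\<lambda>_. 0)"
    by (auto simp: char_tape_def unary_tape_def)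
  have "reaches machine
    (3, [(x, h), (w, 0), (w, 0), (w, 0), (w, 0), (char_tape 0 {}, 0), (unary_tape 0, - int 0)])
    (pass_time L)
    (3 + 5, [(x, h), (w, 0), (w, 0), (w, 0), (w, 0), (char_tape (L * L) {}, 0),
         (unary_tape (L * L), - int (L * L))])"
  proof (rule pass_reaches[where body = init_body and u = "\<lambda>k. char_tape k {}" and L = L
        and \<tau> = "\<lambda>k. (unary_tape k, - int k)"])
    fix k
    have "char_tape (Suc k) {} = (char_tape k {})(int k := 1)"
      "unary_tape (Suc k) = (unary_tape k)(- int k := 1)"
      by (auto simp: char_tape_def unary_tape_def)
    then show "case init_body [x h, w (int p), w (int q), w (int p + 0), w (int q + 0),
         char_tape k {} (int k), read_tape (unary_tape k, - int k)] of
       (y, a) \<Rightarrow> char_tape (Suc k) {} = (char_tape k {})(int k := y) \<and>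
          (unary_tape (Suc k), - int (Suc k)) = act_tape a (unary_tape k, - int k)" for p q
      by (simp add: init_body_def)
  qed (use w in \<open>simp_all add: code_pass char_tape_def\<close>)
  then show ?thesis by (simp add: z)
qed

lemma count_pass:
  fixes t c :: nat and D :: "nat set"
  defines "g \<equiv> card (cover L w c - D)"
  shows "reaches machine
    (11, [(x, h), (w, 0), (w, 0), (w, 1 + int c), (w, 1 + int c), (char_tape (L * L) D, 0),
         (unary_tape t, 1 - int t)])
    (pass_time L)
    (16, [(x, h), (w, 0), (w, 0), (w, 1 + int c), (w, 1 + int c), (char_tape (L * L) D, 0),
         (unary_tape t, 1 - int t + int (min t g))])"
proof -
  \<comment> \<open>The number of gained pairs with index below \<open>k\<close>; the head of tape 6
    is \<open>min t (?n k)\<close> cells to the right of its start.\<close>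
  let ?n = "\<lambda>k. card {j \<in> cover L w c - D. j < k}"
  have n: "?n (Suc k) = (if k \<in> cover L w c - D then Suc (?n k) else ?n k)" for k
  proof -
    have "{j \<in> cover L w c - D. j < Suc k} =
        (if k \<in> cover L w c - D then insert k {j \<in> cover L w c - D. j < k}
         else {j \<in> cover L w c - D. j < k})"
      by (auto simp: less_Suc_eq)
    then show ?thesis by simp
  qed
  have "?n (L * L) = g"
    unfolding g_def by (rule arg_cong[of _ _ card]) (auto simp: cover_def)
  have "reaches machine
    (11, [(x, h), (w, 0), (w, 0), (w, 1 + int c), (w, 1 + int c), (char_tape (L * L) D, 0),
         (unary_tape t, 1 - int t + int (min t (?n 0)))])
    (pass_time L)
    (11 + 5, [(x, h), (w, 0), (w, 0), (w, 1 + int c), (w, 1 + int c), (char_tape (L * L) D, 0),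
         (unary_tape t, 1 - int t + int (min t (?n (L * L))))])"
  proof (rule pass_reaches[where body = count_body and u = "\<lambda>k. char_tape (L * L) D" and L = L
        and \<tau> = "\<lambda>k. (unary_tape t, 1 - int t + int (min t (?n k)))"])
    fix p q k assume pq: "p < L" "q < L" "k = p * L + q"
    have "unary_tape t (1 - int t + int (min t (?n k))) \<noteq> 0 \<longleftrightarrow> ?n k < t"
      by (auto simp: unary_tape_def)
    then show "case count_body [x h, w (int p), w (int q), w (int p + (1 + int c)),
          w (int q + (1 + int c)), char_tape (L * L) D (int k),
          read_tape (unary_tape t, 1 - int t + int (min t (?n k)))] of
       (y, a) \<Rightarrow> char_tape (L * L) D = (char_tape (L * L) D)(int k := y) \<and>
          (unary_tape t, 1 - int t + int (min t (?n (Suc k)))) =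
            act_tape a (unary_tape t, 1 - int t + int (min t (?n k)))"
      unfolding n by (simp add: count_body_def uncovered_pair_iff[OF pq])
  qed (use w in \<open>simp_all add: code_pass char_tape_def\<close>)
  then show ?thesis
    unfolding \<open>?n (L * L) = g\<close> by simp
qed

lemma update_pass:
  "reaches machine
    (17, [(x, h), (w, 0), (w, 0), (w, 1 + int c), (w, 1 + int c), (char_tape (L * L) D, 0), \<tau>])
    (pass_time L)
    (22, [(x, h), (w, 0), (w, 0), (w, 1 + int c), (w, 1 + int c),
         (char_tape (L * L) (D \<union> cover L w c), 0), \<tau>])"
proof -
  let ?D = "\<lambda>k. D \<union> {j \<in> cover L w c. j < k}"
  have D: "?D (Suc k) = (if k \<in> cover L w c - D then insert k (?D k) else ?D k)" for k
    by (auto simp: less_Suc_eq)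
  have "?D (L * L) = D \<union> cover L w c"
    by (auto simp: cover_def)
  have "reaches machine
    (17, [(x, h), (w, 0), (w, 0), (w, 1 + int c), (w, 1 + int c), (char_tape (L * L) (?D 0), 0), \<tau>])
    (pass_time L)
    (17 + 5, [(x, h), (w, 0), (w, 0), (w, 1 + int c), (w, 1 + int c),
       (char_tape (L * L) (?D (L * L)), 0), \<tau>])"
  proof (rule pass_reaches[where body = update_body and u = "\<lambda>k. char_tape (L * L) (?D k)"
        and L = L and \<tau> = "\<lambda>k. \<tau>"])
    fix p q k assume pq: "p < L" "q < L" "k = p * L + q"
    \<comment> \<open>Marks made during the pass have smaller indices, so the test at
      \<open>k\<close> still sees the old mark.\<close>
    have "k \<in> cover L w c - ?D k \<longleftrightarrow> k \<in> cover L w c - D"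
      by auto
    then show "case update_body [x h, w (int p), w (int q), w (int p + (1 + int c)),
          w (int q + (1 + int c)), char_tape (L * L) (?D k) (int k), read_tape \<tau>] of
       (y, a) \<Rightarrow> char_tape (L * L) (?D (Suc k)) = (char_tape (L * L) (?D k))(int k := y) \<and>
          \<tau> = act_tape a \<tau>"
      unfolding D by (simp add: update_body_def uncovered_pair_iff[OF pq]
          char_tape_update[OF pair_index(3)[OF pq]] act_read_tape)
  qed (use w in \<open>simp_all add: code_pass char_tape_def\<close>)
  then show ?thesis by (simp add: \<open>?D (L * L) = D \<union> cover L w c\<close>)
qed

text \<open>The head runs left to the blank at \<open>- int t\<close> and steps back; that last step
  also moves tapes 0, 3 and 4 to the next column.\<close>

lemma rewind_threshold:
  assumes "j \<le> t"
  shows "reaches machine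
    (23, [(x, h), (w, 0), (w, 0), (w, d), (w, d), (u, 0), (unary_tape t, int j - int t)])
    (j + 1)
    (10, [(x, h + 1), (w, 0), (w, 0), (w, d + 1), (w, d + 1), (u, 0), (unary_tape t, 1 - int t)])"
proof -
  let ?f = "\<lambda>i. (23, [(x, h), (w, 0), (w, 0), (w, d), (w, d), (u, 0),
    (unary_tape t, int j - int i - int t)])"
  have "reaches machine (?f 0) (j * 1) (?f j)"
  proof (rule reaches_loop)
    fix i assume "i < j"
    then show "reaches machine (?f i) 1 (?f (Suc i))"
      using assms by (intro reaches_step) (simp add: machine_sim unary_tape_def)
  qed
  also have "reaches machine (?f j) 1
    (10, [(x, h + 1), (w, 0), (w, 0), (w, d + 1), (w, d + 1), (u, 0), (unary_tape t, 1 - int t)])"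
    by (intro reaches_step) (simp add: machine_sim unary_tape_def)
  finally show ?thesis by simp
qed

lemma column_reaches:
  assumes "c < m" "0 < t" "t \<le> L * L"
  shows "reaches machine (col_config L m w 10 t C (int c)) (col_time L)
    (col_config L m w 10 t (if t \<le> gain (cover L w) C c then insert c C else C) (int (Suc c)))"
proof -
  let ?D = "\<Union> (cover L w ` C)"
  let ?g = "card (cover L w c - ?D)"
  let ?cfg = "\<lambda>q C D r. (q, [(char_tape m C, int c), (w, 0), (w, 0), (w, 1 + int c), (w, 1 + int c),
     (char_tape (L * L) D, 0), (unary_tape t, r - int t)])"
  have "reaches machine (col_config L m w 10 t C (int c)) 1 (?cfg 11 C ?D 1)"
    using assms by (intro reaches_step) (simp add: machine_sim col_config_def char_tape_def)
  also have "reaches machine (?cfg 11 C ?D 1) (pass_time L) (?cfg 16 C ?D (1 + int (min t ?g)))"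
    using count_pass by (simp add: algebra_simps)
  finally have start: "reaches machine (col_config L m w 10 t C (int c)) (1 + pass_time L)
      (?cfg 16 C ?D (1 + int (min t ?g)))" .
  show ?thesis
  proof (cases "t \<le> ?g")
    \<comment> \<open>The counter has saturated and stands on the blank at position 1; in the other
      case it is still on a one.\<close>
    case True
    note start
    also have "reaches machine (?cfg 16 C ?D (1 + int (min t ?g))) 1 (?cfg 17 C ?D (1 + int t))"
      using True by (intro reaches_step) (simp add: machine_sim unary_tape_def)
    also have "reaches machine (?cfg 17 C ?D (1 + int t)) (pass_time L)
        (?cfg 22 C (\<Union> (cover L w ` insert c C)) (1 + int t))"
      using update_pass[of "char_tape m C" "int c" c ?D] by (simp add: Un_commute)
    also have "reaches machine (?cfg 22 C (\<Union> (cover L w ` insert c C)) (1 + int t)) 1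
        (?cfg 23 (insert c C) (\<Union> (cover L w ` insert c C)) (int t))"
      using char_tape_update[OF \<open>c < m\<close>, of C]
      by (intro reaches_step) (simp add: machine_sim)
    also have "reaches machine (?cfg 23 (insert c C) (\<Union> (cover L w ` insert c C)) (int t)) (t + 1)
        (col_config L m w 10 t (insert c C) (int (Suc c)))"
      using rewind_threshold[of t t "char_tape m (insert c C)" "int c" "1 + int c"] by (simp add: col_config_def algebra_simps)
    finally show ?thesis
      using True assms by (auto intro: reaches_mono simp: gain_def col_time_def)
  next
    case False
    note start
    also have "reaches machine (?cfg 16 C ?D (1 + int (min t ?g))) 1 (?cfg 23 C ?D (int ?g))"
      using False by (intro reaches_step) (simp add: machine_sim unary_tape_def)
    also have "reaches machine (?cfg 23 C ?D (int ?g)) (?g + 1)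
        (col_config L m w 10 t C (int (Suc c)))"
      using rewind_threshold[of ?g t "char_tape m C" "int c" "1 + int c"] False by (simp add: col_config_def algebra_simps)
    finally show ?thesis
      using False assms by (auto intro: reaches_mono simp: gain_def col_time_def)
  qed
qed

lemma round_reaches:
  assumes "0 < t" "t \<le> L * L"
  shows "reaches machine (col_config L m w 9 t C 0) (round_time L m)
    (col_config L m w 9 (t - 1) (sweep (cover L w) t C m) 0)"
proof -
  let ?C = "sweep (cover L w) t C"
  have "reaches machine (col_config L m w 9 t C 0) 1 (col_config L m w 10 t (?C 0) (int 0))"
    using assms by (intro reaches_step) (simp add: machine_sim col_config_def unary_tape_def)
  also have "reaches machine (col_config L m w 10 t (?C 0) (int 0)) (m * col_time L)
      (col_config L m w 10 t (?C m) (int m))"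
    using reaches_loop[of m machine "\<lambda>c. col_config L m w 10 t (?C c) (int c)"] column_reaches assms
    by simp
  also have "reaches machine (col_config L m w 10 t (?C m) (int m)) 1
      (col_config L m w 24 t (?C m) (int m - 1 - int 0))"
    by (intro reaches_step) (simp add: machine_sim col_config_def char_tape_def)
  also have "reaches machine (col_config L m w 24 t (?C m) (int m - 1 - int 0)) (m * 1)
      (col_config L m w 24 t (?C m) (int m - 1 - int m))"
  proof (rule reaches_loop[of m machine "\<lambda>i. col_config L m w 24 t (?C m) (int m - 1 - int i)"])
    fix i assume "i < m"
    then show "reaches machine (col_config L m w 24 t (?C m) (int m - 1 - int i)) 1
        (col_config L m w 24 t (?C m) (int m - 1 - int (Suc i)))"
      by (intro reaches_step) (simp add: machine_sim col_config_def char_tape_def)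
  qed
  \<comment> \<open>One step erases the leftmost one, which lowers the threshold, and returns the
    heads to column 0.\<close>
  also have "reaches machine (col_config L m w 24 t (?C m) (int m - 1 - int m)) 1
      (col_config L m w 9 (t - 1) (?C m) 0)"
  proof -
    have "unary_tape (t - 1) = (unary_tape t)(1 - int t := 0)"
      using assms by (auto simp: unary_tape_def)
    then show ?thesis
      using assms
      by (intro reaches_step) (simp add: machine_sim col_config_def char_tape_def of_nat_diff)
  qed
  finally show ?thesis
    by (rule reaches_mono) (simp add: round_time_def)
qed

lemma greedy_reaches:
  "reaches machine (col_config L m w 9 (L * L) {} 0) (L * L * round_time L m + 1)
    (col_config L m w 25 0 (greedy (cover L w) m (L * L) (L * L)) 0)"
proof -
  let ?f = "\<lambda>i. col_config L m w 9 (L * L - i) (greedy (cover L w) m (L * L) i) 0"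
  have "reaches machine (?f 0) (L * L * round_time L m) (?f (L * L))"
  proof (rule reaches_loop)
    fix i assume "i < L * L"
    then show "reaches machine (?f i) (round_time L m) (?f (Suc i))"
      using round_reaches[of "L * L - i" "greedy (cover L w) m (L * L) i"] by simp
  qed
  also have "reaches machine (?f (L * L)) 1
      (col_config L m w 25 0 (greedy (cover L w) m (L * L) (L * L)) 0)"
    by (intro reaches_step) (simp add: machine_sim col_config_def unary_tape_def)
  finally show ?thesis by simp
qed

text \<open>The row of the whole set comes first, so the first symbol 3 tells the machine where the
  \<open>m\<close> columns end.\<close>

lemma setup_reaches:
  assumes three: "\<And>i. 0 \<le> i \<Longrightarrow> i < int m \<Longrightarrow> w i \<noteq> 3" "w (int m) = 3"
  shows "reaches machine (0, (w, 0) # replicate 6 (\<lambda>_. 0, 0)) (2 * L + pass_time L + 4)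
    (col_config L m w 9 (L * L) {} 0)"
proof -
  have "m < L"
    using w[of "int m"] three by auto
  let ?z = "(\<lambda>_. 0, 0)"
  let ?e = "char_tape m {}"
  \<comment> \<open>Tape 0 and the copies before cell \<open>i\<close> is treated: from
    \<open>i\<close> on, tape 0 still holds the input and the copies are blank.\<close>
  define x where
    "x i = (\<lambda>j. if 0 \<le> j \<and> j < int m \<and> j < i then 1 else if j < i then 0 else w j)" for i
  define cp where "cp i = (\<lambda>j. if j < i then w j else 0)" for i
  let ?f = "\<lambda>q i. (q, [(x i, i), (cp i, i), (cp i, i), (cp i, i), (cp i, i), ?z, ?z])"
  let ?r = "\<lambda>q i. (q, [(?e, i), (w, i), (w, i), (w, i), (w, i), ?z, ?z])"
  have w0: "w j = 0" if "j < 0 \<or> int L \<le> j" for j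
    using w[of j] that by auto
  have cp: "(cp i)(i := w i) = cp (i + 1)" for i
    by (auto simp: fun_eq_iff cp_def)
  have x1: "(x i)(i := Suc 0) = x (i + 1)" if "0 \<le> i" "i < int m" for i
    using that by (auto simp: fun_eq_iff x_def)
  have x0: "(x i)(i := 0) = x (i + 1)" if "int m \<le> i" for i
    using that by (auto simp: fun_eq_iff x_def)
  have read: "x i i = w i" "cp i i = 0" for i
    by (simp_all add: x_def cp_def)
  have start: "x 0 = w" "cp 0 = (\<lambda>_. 0)"
    using w0 by (auto simp: fun_eq_iff x_def cp_def)
  have stop: "x (int L) = ?e" "cp (int L) = w"
    using w0 \<open>m < L\<close> by (auto simp: fun_eq_iff x_def cp_def char_tape_def)
  have "(0, (w, 0) # replicate 6 ?z) = ?f 0 (int 0)"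
    by (simp add: start numeral_eq_Suc)
  moreover have "reaches machine (?f 0 (int 0)) (m * 1) (?f 0 (int m))"
  proof (rule reaches_loop[of m machine "\<lambda>i. ?f 0 (int i)"])
    fix i assume "i < m"
    then show "reaches machine (?f 0 (int i)) 1 (?f 0 (int (Suc i)))"
      using three(1)[of "int i"]
      by (intro reaches_step) (simp add: machine_sim cp x1 read add.commute)
  qed
  ultimately have "reaches machine (0, (w, 0) # replicate 6 ?z) (m * 1) (?f 0 (int m))"
    by simp
  also have "reaches machine (?f 0 (int m)) 1 (?f 1 (int m + int 0))"
    using three by (intro reaches_step) (simp add: machine_sim read)
  also have "reaches machine (?f 1 (int m + int 0)) ((L - m) * 1) (?f 1 (int m + int (L - m)))"
  proof (rule reaches_loop[of "L - m" machine "\<lambda>i. ?f 1 (int m + int i)"])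
    fix i assume "i < L - m"
    then have "w (int m + int i) \<noteq> 0"
      using w by auto
    then show "reaches machine (?f 1 (int m + int i)) 1 (?f 1 (int m + int (Suc i)))"
      using cp[of "int m + int i"] x0[of "int m + int i"]
      by (intro reaches_step) (simp add: machine_sim read add_ac)
  qed
  also have "?f 1 (int m + int (L - m)) = ?r 1 (int L)"
    using \<open>m < L\<close> by (simp add: stop of_nat_diff)
  also have "reaches machine (?r 1 (int L)) 1 (?r 2 (int L - 1 - int 0))"
    using \<open>m < L\<close> w0[of "int L"]
    by (intro reaches_step) (simp add: machine_sim char_tape_def)
  also have "reaches machine (?r 2 (int L - 1 - int 0)) (L * 1) (?r 2 (int L - 1 - int L))"
  proof (rule reaches_loop[of L machine "\<lambda>i. ?r 2 (int L - 1 - int i)"])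
    fix i assume "i < L"
    then show "reaches machine (?r 2 (int L - 1 - int i)) 1 (?r 2 (int L - 1 - int (Suc i)))"
      using w[of "int L - 1 - int i"] by (intro reaches_step) (simp add: machine_sim)
  qed
  also have "reaches machine (?r 2 (int L - 1 - int L)) 1 (?r 3 0)"
    using w0[of "-1"] by (intro reaches_step) (simp add: machine_sim)
  also note init_pass
  also have "reaches machine (8, [(?e, 0), (w, 0), (w, 0), (w, 0), (w, 0),
      (char_tape (L * L) {}, 0), (unary_tape (L * L), - int (L * L))]) 1
      (col_config L m w 9 (L * L) {} 0)"
    by (intro reaches_step) (simp add: machine_sim col_config_def)
  finally show ?thesis
    by (rule reaches_mono) (use \<open>m < L\<close> in simp)
qed

end


section \<open>Columns of the incidence matrix as covers\<close>

lemma nth_concat_uniform: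
  assumes "\<And>r. r \<in> set rows \<Longrightarrow> length r = k" "i < length rows" "j < k"
  shows "concat rows ! (i * k + j) = rows ! i ! j"
  using assms
proof (induction rows arbitrary: i)
  case (Cons r rows)
  then show ?case
    by (cases i) (auto simp: nth_append)
qed simp

lemma length_concat_uniform:
  assumes "\<And>r. r \<in> set rows \<Longrightarrow> length r = k"
  shows "length (concat rows) = length rows * k"
  using assms by (induction rows) auto

lemma word_contents_int: "i < length v \<Longrightarrow> word_contents v (int i) = v ! i"
  by (simp add: word_contents_def)

definition separates :: "'a list \<Rightarrow> 'a set list \<Rightarrow> nat \<Rightarrow> (nat \<times> nat) set" where
  "separates xs bs c =
    {(r, r'). r < length bs \<and> r' < length bs \<and> xs ! c \<in> bs ! r \<and> xs ! c \<notin> bs ! r'}"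

text \<open>Inclusion of \<open>bs ! r\<close> in \<open>bs ! r'\<close> fails iff some column
  separates the pair, and after restriction iff some column of \<open>C\<close> does.\<close>

lemma compare_set_iff:
  assumes "enumerates xs bs A B" "C \<subseteq> {..<length xs}"
  shows "compare_set A B (nth xs ` C) \<longleftrightarrow>
    \<Union> (separates xs bs ` C) = \<Union> (separates xs bs ` {..<length xs})"
proof -
  have xs: "set xs = A" and bs: "set bs = B" "B \<subseteq> Pow A"
    using assms by (auto simp: enumerates_def)
  have 1: "(\<exists>c<length xs. (r, r') \<in> separates xs bs c) \<longleftrightarrow> \<not> bs ! r \<subseteq> bs ! r'"
    if "r < length bs" "r' < length bs" for r r'
  proof -
    have "bs ! r \<subseteq> set xs"
      using that bs xs nth_mem[of r bs] by auto
    then show ?thesis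
      using that by (simp add: separates_def in_set_conv_nth subset_iff) blast
  qed
  have 2: "(\<exists>c\<in>C. (r, r') \<in> separates xs bs c) \<longleftrightarrow>
      \<not> bs ! r \<inter> nth xs ` C \<subseteq> bs ! r' \<inter> nth xs ` C"
    if "r < length bs" "r' < length bs" for r r'
    using that by (auto simp: separates_def)
  have 3: "(bs ! r \<subseteq> bs ! r' \<longleftrightarrow> bs ! r \<inter> nth xs ` C \<subseteq> bs ! r' \<inter> nth xs ` C) \<longleftrightarrow>
      ((\<exists>c\<in>C. (r, r') \<in> separates xs bs c) \<longleftrightarrow> (\<exists>c<length xs. (r, r') \<in> separates xs bs c))"
    if "r < length bs" "r' < length bs" for r r'
    using 1[OF that] 2[OF that] by argo
  have "nth xs ` C \<subseteq> A"
    using assms(2) xs by auto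
  then have "compare_set A B (nth xs ` C) \<longleftrightarrow> (\<forall>r<length bs. \<forall>r'<length bs.
      bs ! r \<subseteq> bs ! r' \<longleftrightarrow> bs ! r \<inter> nth xs ` C \<subseteq> bs ! r' \<inter> nth xs ` C)"
    by (simp only: compare_set_def bs(1)[symmetric] all_set_conv_all_nth simp_thms)
  also have "\<dots> \<longleftrightarrow> (\<forall>r<length bs. \<forall>r'<length bs.
      (\<exists>c\<in>C. (r, r') \<in> separates xs bs c) \<longleftrightarrow> (\<exists>c<length xs. (r, r') \<in> separates xs bs c))"
    by (intro all_cong1 imp_cong refl) (rule 3)
  also have "\<dots> \<longleftrightarrow> \<Union> (separates xs bs ` C) = \<Union> (separates xs bs ` {..<length xs})"
  proof -
    have "r < length bs \<and> r' < length bs" if "(r, r') \<in> separates xs bs c" for r r' c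
      using that by (simp add: separates_def)
    then show ?thesis
      unfolding set_eq_iff UN_iff split_paired_All lessThan_iff Bex_def by blast
  qed
  finally show ?thesis .
qed

section \<open>Reading the incidence matrix off the instance word\<close>

context
  fixes xs :: "'a list" and bs :: "'a set list" and k L :: nat and w :: "int \<Rightarrow> nat"
  defines "k \<equiv> length xs + 1"
    and "L \<equiv> length (instance_word xs bs)"
    and "w \<equiv> word_contents (instance_word xs bs)"
begin

lemma length_instance_word: "L = (length bs + 1) * k"
  unfolding L_def instance_word_def
  by (subst length_concat_uniform[of _ k]) (auto simp: subset_word_def k_def)

lemma index_less:
  assumes "r \<le> length bs" "c < k"
  shows "r * k + c < L"
proof -
  have "r * k + c < Suc r * k"
    using assms by simp
  also have "\<dots> \<le> (length bs + 1) * k"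
    using assms by (intro mult_le_mono1) simp
  finally show ?thesis
    by (simp only: length_instance_word)
qed

lemma word_entry:
  assumes "r \<le> length bs" "c < k"
  shows "w (int (r * k + c)) =
    (if c = length xs then 3 else if xs ! c \<in> (set xs # bs) ! r then 2 else 1)"
proof -
  have "instance_word xs bs ! (r * k + c) =
      map (\<lambda>b. subset_word xs b @ [3]) (set xs # bs) ! r ! c"
    unfolding instance_word_def using assms
    by (intro nth_concat_uniform) (auto simp: subset_word_def k_def)
  also have "\<dots> = (subset_word xs ((set xs # bs) ! r) @ [3]) ! c"
    using assms by (subst nth_map) auto
  also have "\<dots> = (if c = length xs then 3 else if xs ! c \<in> (set xs # bs) ! r then 2 else 1)"
    using assms by (simp add: subset_word_def nth_append k_def)
  finally have "instance_word xs bs ! (r * k + c) =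
    (if c = length xs then 3 else if xs ! c \<in> (set xs # bs) ! r then 2 else 1)" .
  moreover have "w (int (r * k + c)) = instance_word xs bs ! (r * k + c)"
    using index_less[OF assms] unfolding w_def L_def by (rule word_contents_int)
  ultimately show ?thesis by simp
qed

lemma index_cases:
  assumes "p < L"
  obtains r c where "r \<le> length bs" "c < k" "p = r * k + c"
proof
  show "p div k \<le> length bs"
    using assms less_mult_imp_div_less[of p "length bs + 1" k] by (simp add: length_instance_word)
  show "p mod k < k"
    by (simp add: k_def)
  show "p = p div k * k + p mod k"
    by simp
qed

lemma word_nonzero: "w i \<noteq> 0 \<longleftrightarrow> 0 \<le> i \<and> i < int L"
proof
  assume "0 \<le> i \<and> i < int L"
  then obtain p where p: "i = int p" "p < L"
    by (metis nonneg_int_cases of_nat_less_iff)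
  obtain r c where "r \<le> length bs" "c < k" "p = r * k + c"
    using index_cases[OF p(2)] .
  then show "w i \<noteq> 0"
    using word_entry[of r c] p by simp
qed (auto simp: w_def word_contents_def L_def split: if_splits)

lemma word_three:
  assumes "p < L"
  shows "w (int p) = 3 \<longleftrightarrow> (\<exists>r\<le>length bs. p = r * k + length xs)"
proof
  assume three: "w (int p) = 3"
  obtain r c where "r \<le> length bs" "c < k" "p = r * k + c"
    using index_cases[OF assms] .
  then show "\<exists>r\<le>length bs. p = r * k + length xs"
    using word_entry[of r c] three by (auto split: if_splits)
next
  assume "\<exists>r\<le>length bs. p = r * k + length xs"
  then show "w (int p) = 3"
    using word_entry[of _ "length xs"] by (auto simp: k_def)
qed

text \<open>Row 0 is that of the whole set, so the row after row \<open>r\<close> is that of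
  \<open>bs ! r\<close>. After the last row the head sees a blank, so that row end occurs in no
  covered pair.\<close>

lemma word_next_row:
  assumes "c < length xs" "r \<le> length bs"
  shows "w (int (r * k + length xs) + (1 + int c)) =
    (if r < length bs then if xs ! c \<in> bs ! r then 2 else 1 else 0)"
proof (cases "r < length bs")
  case True
  have eq: "int (r * k + length xs) + (1 + int c) = int (Suc r * k + c)"
    by (simp add: k_def)
  show ?thesis
    unfolding eq using True word_entry[of "Suc r" c] assms by (simp add: k_def)
next
  case False
  then have "int (r * k + length xs) + (1 + int c) \<ge> int L"
    using assms unfolding length_instance_word by (simp add: k_def)
  then show ?thesis
    using False word_nonzero[of "int (r * k + length xs) + (1 + int c)"] by auto
qed

text \<open>The index on tape 5 of the two row ends that precede \<open>bs ! r\<close> and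
  \<open>bs ! r'\<close>.\<close>

definition pair_code :: "nat \<times> nat \<Rightarrow> nat" where
  "pair_code = (\<lambda>(r, r'). (r * k + length xs) * L + (r' * k + length xs))"

lemma row_end_less:
  assumes "r \<le> length bs"
  shows "r * k + length xs < L"
  using assms by (rule index_less) (simp add: k_def)

lemma cover_eq:
  assumes "c < length xs"
  shows "cover L w c = pair_code ` separates xs bs c"
proof (intro set_eqI iffI)
  fix i assume i: "i \<in> cover L w c"
  have "0 < L"
    unfolding length_instance_word by (simp add: k_def)
  then have lt: "i div L < L" "i mod L < L"
    using i by (auto simp: cover_def less_mult_imp_div_less)
  obtain r r' where r: "r \<le> length bs" "i div L = r * k + length xs"
      and r': "r' \<le> length bs" "i mod L = r' * k + length xs"
    using i word_three lt unfolding cover_def by blast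
  have "w (int (i div L) + (1 + int c)) = 2" "w (int (i mod L) + (1 + int c)) = 1"
    using i by (simp_all add: cover_def)
  then have "(r, r') \<in> separates xs bs c"
    unfolding r(2) r'(2) word_next_row[OF assms r(1)] word_next_row[OF assms r'(1)]
    by (auto simp: separates_def split: if_splits)
  moreover have "i = pair_code (r, r')"
    unfolding pair_code_def case_prod_conv r(2)[symmetric] r'(2)[symmetric] by simp
  ultimately show "i \<in> pair_code ` separates xs bs c"
    by blast
next
  fix i assume "i \<in> pair_code ` separates xs bs c"
  then obtain r r' where i: "i = pair_code (r, r')" and r: "r < length bs" "r' < length bs"
    and sep: "xs ! c \<in> bs ! r" "xs ! c \<notin> bs ! r'"
    by (auto simp: separates_def)
  define p q where "p = r * k + length xs" and "q = r' * k + length xs"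
  have pq: "p < L" "q < L" "i = p * L + q"
    using row_end_less r i by (auto simp: p_def q_def pair_code_def)
  have "w (int p) = 3" "w (int q) = 3"
    using word_three[OF pq(1)] word_three[OF pq(2)] r by (auto simp: p_def q_def)
  moreover have "w (int p + (1 + int c)) = 2" "w (int q + (1 + int c)) = 1"
    using word_next_row[OF assms, of r] word_next_row[OF assms, of r'] r sep
    by (simp_all add: p_def q_def)
  ultimately show "i \<in> cover L w c"
    unfolding cover_def using pair_index[OF pq] by simp
qed

text \<open>Row ends are below \<open>L\<close>, so division by \<open>L\<close> with remainder
  recovers both.\<close>

lemma inj_pair_code: "inj_on pair_code ({..<length bs} \<times> {..<length bs})"
proof (rule inj_onI, clarify)
  fix r r' s s' assume r: "r < length bs" "r' < length bs" "s < length bs" "s' < length bs"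
    and eq: "pair_code (r, r') = pair_code (s, s')"
  have eq': "(r * k + length xs) * L + (r' * k + length xs) =
      (s * k + length xs) * L + (s' * k + length xs)"
    using eq unfolding pair_code_def case_prod_conv .
  note less = r[THEN less_imp_le, THEN row_end_less]
  have "r * k + length xs = s * k + length xs"
    using pair_index(1)[OF less(1,2) refl] pair_index(1)[OF less(3,4) eq'] by (rule trans[OF sym])
  moreover have "r' * k + length xs = s' * k + length xs"
    using pair_index(2)[OF less(1,2) refl] pair_index(2)[OF less(3,4) eq'] by (rule trans[OF sym])
  moreover have "k \<noteq> 0"
    by (simp add: k_def)
  ultimately show "r = s \<and> r' = s'"
    by simp
qed

section \<open>Approximation guarantee and output of the machine\<close>

lemma cover_compare_set:
  assumes "enumerates xs bs A B" "C \<subseteq> {..<length xs}"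
  shows "compare_set A B (nth xs ` C) \<longleftrightarrow>
    \<Union> (cover L w ` C) = \<Union> (cover L w ` {..<length xs})"
proof -
  have eq: "\<Union> (cover L w ` D) = pair_code ` \<Union> (separates xs bs ` D)"
    if "D \<subseteq> {..<length xs}" for D
    using that cover_eq by (auto simp: image_UN subset_iff)
  have "\<Union> (separates xs bs ` D) \<subseteq> {..<length bs} \<times> {..<length bs}" for D
    by (auto simp: separates_def)
  then show ?thesis
    unfolding compare_set_iff[OF assms] eq[OF assms(2)] eq[OF order_refl]
    by (intro inj_on_image_eq_iff[OF inj_pair_code, symmetric])
qed

text \<open>Counting pairs of rows instead of pairs of positions makes the factor depend on
  \<open>card B\<close> and not on \<open>L\<close>.\<close>

lemma card_cover_le: "card (\<Union> (cover L w ` {..<length xs})) \<le> length bs * length bs"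
proof -
  have "\<Union> (cover L w ` {..<length xs}) \<subseteq> pair_code ` ({..<length bs} \<times> {..<length bs})"
    by (auto simp: cover_eq separates_def)
  then have "card (\<Union> (cover L w ` {..<length xs}))
      \<le> card (pair_code ` ({..<length bs} \<times> {..<length bs}))"
    by (intro card_mono) auto
  also have "\<dots> = length bs * length bs"
    by (simp add: card_image[OF inj_pair_code])
  finally show ?thesis .
qed

lemma greedy_compare_set:
  assumes enum: "enumerates xs bs A B"
  defines "X \<equiv> nth xs ` greedy (cover L w) (length xs) (L * L) (L * L)"
  shows "compare_set A B X"
    and "card X \<le> (1 + 2 * ln (card B)) * min_compare_card A B"
proof -
  let ?m = "length xs" and ?S = "cover L w"
  let ?C = "greedy ?S ?m (L * L) (L * L)"
  have A: "set xs = A" "distinct xs" and B: "card B = length bs"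
    using enum by (auto simp: enumerates_def distinct_card)
  have inj: "inj_on (nth xs) {..<?m}"
    using A by (simp add: inj_on_nth)
  have fin: "finite (?S c)" for c
    by (rule finite_subset[of _ "{..<L * L}"]) (auto simp: cover_def)
  have bound: "card (?S c) \<le> L * L" for c
  proof -
    have "card (?S c) \<le> card {..<L * L}"
      by (intro card_mono) (auto simp: cover_def)
    then show ?thesis by simp
  qed
  have "0 < L * L"
    unfolding length_instance_word by (simp add: k_def)
  have C: "?C \<subseteq> {..<?m}"
    by (rule greedy_subset)
  have "compare_set A B (nth xs ` {..<?m})"
    by (simp add: cover_compare_set[OF enum])
  moreover have "finite {X. compare_set A B X}"
    by (rule finite_subset[of _ "Pow A"]) (auto simp: compare_set_def A(1)[symmetric])
  ultimately have "min_compare_card A B \<in> card ` {X. compare_set A B X}"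
    unfolding min_compare_card_def by (intro Min_in) auto
  then obtain Y where Y: "compare_set A B Y" "card Y = min_compare_card A B"
    by auto
  \<comment> \<open>The indices of an optimal compare set are the cover against which the greedy
    result is measured.\<close>
  define P where "P = {c. c < ?m \<and> xs ! c \<in> Y}"
  have P: "P \<subseteq> {..<?m}"
    by (auto simp: P_def)
  have "Y \<subseteq> set xs"
    using Y A by (simp add: compare_set_def)
  then have YP: "Y = nth xs ` P"
    by (auto simp: P_def in_set_conv_nth subset_iff image_iff)
  have cardP: "card P = min_compare_card A B"
    using card_image[OF inj_on_subset[OF inj P]] Y YP by simp
  have "\<Union> (?S ` P) = \<Union> (?S ` {..<?m})"
    using Y(1) cover_compare_set[OF enum P] YP by simp
  note approx = greedy_approx[OF fin bound \<open>0 < L * L\<close> P this]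
  show "compare_set A B X"
    unfolding X_def cover_compare_set[OF enum C] by (rule approx(1))
  \<comment> \<open>Squaring \<open>card B\<close> only doubles the logarithm; if nothing has to be
    covered, \<open>ln 0 = 0\<close> applies.\<close>
  have "ln (real (card (\<Union> (?S ` {..<?m})))) \<le> 2 * ln (real (card B))"
  proof (cases "card (\<Union> (?S ` {..<?m})) = 0")
    case True
    then show ?thesis
      by (cases "card B") auto
  next
    case False
    then have "0 < length bs"
      using card_cover_le by (cases "length bs") auto
    have "real (card (\<Union> (?S ` {..<?m}))) \<le> real (length bs * length bs)"
      using card_cover_le by (simp only: of_nat_le_iff)
    then have "ln (real (card (\<Union> (?S ` {..<?m})))) \<le> ln (real (length bs * length bs))"
      using False by (intro ln_mono) auto
    also have "\<dots> = 2 * ln (real (card B))"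
      using \<open>0 < length bs\<close> B by (simp add: ln_mult)
    finally show ?thesis .
  qed
  then have "real (card P) * (1 + ln (card (\<Union> (?S ` {..<?m}))))
      \<le> real (card P) * (1 + 2 * ln (card B))"
    by (intro mult_left_mono) auto
  with approx(2) have "card ?C \<le> real (card P) * (1 + 2 * ln (card B))"
    by linarith
  moreover have "card X = card ?C"
    unfolding X_def using card_image[OF inj_on_subset[OF inj C]] .
  ultimately show "card X \<le> (1 + 2 * ln (card B)) * min_compare_card A B"
    by (simp add: cardP mult.commute)
qed

lemma machine_outputs:
  assumes "distinct xs"
  defines "C \<equiv> greedy (cover L w) (length xs) (L * L) (L * L)"
  shows "tm_outputs_within machine (instance_word xs bs)
    (2 * L + pass_time L + 4 + (L * L * round_time L (length xs) + 1))
    (subset_word xs (nth xs ` C))"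
proof -
  let ?m = "length xs"
  have C: "C \<subseteq> {..<?m}"
    unfolding C_def by (rule greedy_subset)
  have three: "w (int i) \<noteq> 3" if "i < ?m" for i
    using word_entry[of 0 i] that by (simp add: k_def)
  have "w (int ?m) = 3"
    using word_entry[of 0 ?m] by (simp add: k_def)
  have init: "tm_init machine (instance_word xs bs) = (0, (w, 0) # replicate 6 (\<lambda>_. 0, 0))"
    by (auto simp: tm_init_def w_def word_contents_def)
  have "reaches machine (tm_init machine (instance_word xs bs)) (2 * L + pass_time L + 4)
      (col_config L ?m w 9 (L * L) {} 0)"
    unfolding init
  proof (rule setup_reaches[OF word_nonzero])
    fix i :: int assume "0 \<le> i" "i < int ?m"
    then show "w i \<noteq> 3"
      using three[of "nat i"] by simp
  qed fact
  also note greedy_reaches[OF word_nonzero, of ?m]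
  finally have "reaches machine (tm_init machine (instance_word xs bs))
      (2 * L + pass_time L + 4 + (L * L * round_time L ?m + 1)) (col_config L ?m w 25 0 C 0)"
    unfolding C_def .
  then have "(tm_step machine ^^ (2 * L + pass_time L + 4 + (L * L * round_time L ?m + 1)))
      (tm_init machine (instance_word xs bs)) = col_config L ?m w 25 0 C 0"
    using reaches_halted[of machine] by (simp add: col_config_def)
  moreover have "char_tape ?m C = word_contents (subset_word xs (nth xs ` C))"
  proof
    fix i :: int
    have "xs ! nat i \<in> nth xs ` C \<longleftrightarrow> nat i \<in> C" if "0 \<le> i" "i < int ?m"
      using that C \<open>distinct xs\<close> by (auto simp: nth_eq_iff_index_eq subset_iff)
    then show "char_tape ?m C i = word_contents (subset_word xs (nth xs ` C)) i"
      by (auto simp: char_tape_def word_contents_def subset_word_def)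
  qed
  ultimately show ?thesis
    unfolding tm_outputs_within_def by (auto simp: col_config_def)
qed

end

section \<open>Polynomial time bound and conclusion\<close>

lemma tm_outputs_within_mono:
  assumes "tm_outputs_within M v t y" "t \<le> t'"
  shows "tm_outputs_within M v t' y"
proof -
  obtain ts where ts: "(tm_step M ^^ t) (tm_init M v) = (n_states M, ts)"
      "fst (ts ! 0) = word_contents y"
    using assms by (auto simp: tm_outputs_within_def)
  have "(tm_step M ^^ (t' - t + t)) (tm_init M v) = (n_states M, ts)"
    unfolding funpow_add using ts by (simp add: tm_step_halted)
  then show ?thesis
    using ts assms(2) by (auto simp: tm_outputs_within_def)
qed

lemma machine_time_polynomial:
  "\<exists>p :: nat poly. \<forall>L m. m \<le> L \<longrightarrow>
     2 * L + pass_time L + 4 + (L * L * round_time L m + 1) \<le> poly p L"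
proof -
  \<comment> \<open>With \<open>?X\<close> as the identity polynomial, \<open>?p\<close> repeats the
    time bounds with \<open>m\<close> replaced by \<open>L\<close>.\<close>
  let ?X = "[:0, 1:] :: nat poly"
  let ?pass = "?X * (2 * ?X + 3) + (?X + ?X * ?X + 3)"
  let ?round = "?X * (2 * ?pass + ?X * ?X + 10) + ?X + 3"
  let ?p = "2 * ?X + ?pass + 5 + ?X * ?X * ?round"
  have round: "round_time L m \<le> poly ?round L" if "m \<le> L" for L m
  proof -
    have "poly ?round L = L * col_time L + L + 3"
      by (simp add: col_time_def pass_time_def algebra_simps)
    then show ?thesis
      using that by (auto simp: round_time_def intro!: add_mono mult_le_mono1)
  qed
  have "2 * L + pass_time L + 4 + (L * L * round_time L m + 1) \<le> poly ?p L" if "m \<le> L" for L m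
  proof -
    have "poly ?p L = 2 * L + pass_time L + 4 + (L * L * poly ?round L + 1)"
      by (simp add: pass_time_def algebra_simps)
    then show ?thesis
      using mult_le_mono2[OF round[OF that], of "L * L"] by linarith
  qed
  then show ?thesis by blast
qed

theorem mainTheorem7:
  "\<exists>(M :: tm) (p :: nat poly) (r :: nat \<Rightarrow> real).
     turing_machine M \<and>
     r \<in> O(\<lambda>n. ln (real n)) \<and>
     (\<forall>(A :: 'a set) (B :: 'a set set) xs bs. enumerates xs bs A B \<longrightarrow>
        (\<exists>X. tm_outputs_within M (instance_word xs bs)
                (poly p (length (instance_word xs bs))) (subset_word xs X) \<and>
             compare_set A B X \<and>
             real (card X) \<le> r (card B) * real (min_compare_card A B)))"
proof -
  obtain p :: "nat poly" where p: "\<And>L m. m \<le> L \<Longrightarrow>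
      2 * L + pass_time L + 4 + (L * L * round_time L m + 1) \<le> poly p L"
    using machine_time_polynomial by blast
  \<comment> \<open>The constant 3 works because \<open>ln n \<ge> 1\<close> from
    \<open>n = 3\<close> on, so a third logarithm absorbs the 1.\<close>
  have "(\<lambda>n. 1 + 2 * ln (real n)) \<in> O(\<lambda>n. ln (real n))"
  proof (rule bigoI)
    show "\<forall>\<^sub>F n in sequentially. norm (1 + 2 * ln (real n)) \<le> 3 * norm (ln (real n))"
      using eventually_ge_at_top[of 3]
    proof eventually_elim
      fix n :: nat assume "3 \<le> n"
      then have "exp 1 \<le> real n"
        using exp_le by linarith
      then have "1 \<le> ln (real n)"
        using \<open>3 \<le> n\<close> by (subst ln_ge_iff) auto
      then show "norm (1 + 2 * ln (real n)) \<le> 3 * norm (ln (real n))"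
        by simp
    qed
  qed
  moreover have "\<exists>X. tm_outputs_within machine (instance_word xs bs)
        (poly p (length (instance_word xs bs))) (subset_word xs X) \<and>
      compare_set A B X \<and> real (card X) \<le> (1 + 2 * ln (card B)) * min_compare_card A B"
    if enum: "enumerates xs bs A B" for A :: "'a set" and B xs bs
  proof -
    have "length xs \<le> length (instance_word xs bs)"
      unfolding length_instance_word by simp
    then show ?thesis
      using greedy_compare_set[OF enum] enum p
        tm_outputs_within_mono[OF machine_outputs[of xs bs]]
      unfolding enumerates_def by blast
  qed
  ultimately show ?thesis
    using turing_machine_machine by blast
qed

end
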